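(* Let $\mathcal{H}$ be a non-trivial complex Hilbert space, let $A\neq 0$ be a positive operator on $\mathcal{H}$, and let $T\in \mathcal{B}_{A^{1/2}}(\mathcal{H})$ (i.e. $T$ is $A$-bounded). Then $$r_A(T)\leq \omega_A(T).$$
   Context: $\mathcal{B}(\mathcal{H})$ is the algebra of bounded linear operators on $\mathcal{H}$; inner product $\langle\cdot\mid\cdot\rangle$. $A\in\mathcal{B}(\mathcal{H})$ is positive if $\langle Ax\mid x\rangle\ge 0$ for all $x\in\mathcal{H}$. Put $\langle x\mid y\rangle_A:=\langle Ax\mid y\rangle$ and $\|x\|_A:=\langle x\mid x\rangle_A^{1/2}$ (a seminorm). $\mathcal{B}_{A^{1/2}}(\mathcal{H})$ is the set of $A$-bounded operators: those $T\in\mathcal{B}(\mathcal{H})$ for which there is $\lambda>0$ with $\|Tx\|_A\le\lambda\|x\|_A$ for all $x\in\mathcal{H}$. For such $T$, $\|T\|_A:=\sup\{\|Tx\|_A/\|x\|_A : x\in\overline{\mathcal{R}(A)},\ x\neq 0\}$, where $\mathcal{R}(A)$ is the range of $A$ (closure in the norm of $\mathcal{H}$). The $A$-spectral radius of $T\in\mathcal{B}_{A^{1/2}}(\mathcal{H})$ is $r_A(T):=\inf_{n\in\mathbb{N}^*}\|T^n\|_A^{1/n}$, with $\mathbb{N}^*$ the set of positive integers. The $A$-numerical radius is $\omega_A(T):=\sup\{|\langle Tx\mid x\rangle_A| : x\in\mathcal{H},\ \|x\|_A=1\}$. *)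

theory Defs
  imports "HOL-Analysis.Analysis"
begin

(* Complex Hilbert spaces.  The real scalar multiplication and the norm inherited from
   real_normed_vector are tied to the complex structure by scaleR_scaleC and
   norm_eq_sqrt_cinner.  The inner product is linear in its first argument. *)

class complex_inner_space = real_normed_vector +
  fixes scaleC :: "complex \<Rightarrow> 'a \<Rightarrow> 'a"  (infixr \<open>*\<^sub>C\<close> 75)
    and cinner :: "'a \<Rightarrow> 'a \<Rightarrow> complex"
  assumes scaleC_add_right: "c *\<^sub>C (x + y) = c *\<^sub>C x + c *\<^sub>C y"
    and scaleC_add_left: "(c + d) *\<^sub>C x = c *\<^sub>C x + d *\<^sub>C x"
    and scaleC_scaleC: "c *\<^sub>C d *\<^sub>C x = (c * d) *\<^sub>C x"
    and scaleC_one: "1 *\<^sub>C x = x"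
    and scaleR_scaleC: "r *\<^sub>R x = complex_of_real r *\<^sub>C x"
    and cinner_commute: "cinner x y = cnj (cinner y x)"
    and cinner_add_left: "cinner (x + y) z = cinner x z + cinner y z"
    and cinner_scaleC_left: "cinner (c *\<^sub>C x) y = c * cinner x y"
    and cinner_self_nonneg: "cinner x x \<in> \<real>\<^sub>\<ge>\<^sub>0"
    and cinner_eq_zero_iff: "cinner x x = 0 \<longleftrightarrow> x = 0"
    and norm_eq_sqrt_cinner: "norm x = sqrt (Re (cinner x x))"

class complex_hilbert_space = complex_inner_space + complete_space

text \<open>The complex numbers themselves satisfy the axioms.\<close>

instantiation complex :: complex_hilbert_space
begin

definition scaleC_complex :: "complex \<Rightarrow> complex \<Rightarrow> complex"
  where "scaleC_complex c x = c * x"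

definition cinner_complex :: "complex \<Rightarrow> complex \<Rightarrow> complex"
  where "cinner_complex x y = x * cnj y"

instance
proof
  fix x :: complex
  have *: "cinner x x = complex_of_real ((cmod x)\<^sup>2)"
    unfolding cinner_complex_def by (rule complex_norm_square [symmetric])
  show "cinner x x \<in> \<real>\<^sub>\<ge>\<^sub>0" "norm x = sqrt (Re (cinner x x))"
    "cinner x x = 0 \<longleftrightarrow> x = 0"
    unfolding * by (simp_all only: nonneg_Reals_of_real_iff) simp_all
qed (simp_all add: scaleC_complex_def cinner_complex_def algebra_simps scaleR_conv_of_real)

end

definition bounded_operators :: "('a::complex_hilbert_space \<Rightarrow> 'a) set"
  where "bounded_operators =
    {T. Vector_Spaces.linear scaleC scaleC T \<and> (\<exists>K. \<forall>x. norm (T x) \<le> K * norm x)}"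

definition positive_operator :: "('a::complex_hilbert_space \<Rightarrow> 'a) \<Rightarrow> bool"
  where "positive_operator A \<longleftrightarrow>
    A \<in> bounded_operators \<and> (\<forall>x. cinner (A x) x \<in> \<real>\<^sub>\<ge>\<^sub>0)"

definition A_inner :: "('a::complex_hilbert_space \<Rightarrow> 'a) \<Rightarrow> 'a \<Rightarrow> 'a \<Rightarrow> complex"
  where "A_inner A x y = cinner (A x) y"

(* For a positive operator A, the value A_inner A x x is a nonnegative real number. *)
definition A_seminorm :: "('a::complex_hilbert_space \<Rightarrow> 'a) \<Rightarrow> 'a \<Rightarrow> real"
  where "A_seminorm A x = sqrt (Re (A_inner A x x))"

definition A_bounded_operators ::
    "('a::complex_hilbert_space \<Rightarrow> 'a) \<Rightarrow> ('a \<Rightarrow> 'a) set"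
  where "A_bounded_operators A =
    {T \<in> bounded_operators. \<exists>c>0. \<forall>x. A_seminorm A (T x) \<le> c * A_seminorm A x}"

(* For A positive and nonzero and T an A-bounded operator, the sets in A_opnorm and
   A_numerical_radius are nonempty and bounded above, so the real supremum is the usual one.
   No division by zero occurs in A_opnorm: A is self-adjoint, hence a vector of zero
   A-seminorm is orthogonal to the range of A. *)

definition A_opnorm ::
    "('a::complex_hilbert_space \<Rightarrow> 'a) \<Rightarrow> ('a \<Rightarrow> 'a) \<Rightarrow> real"
  where "A_opnorm A T =
    Sup {A_seminorm A (T x) / A_seminorm A x | x. x \<in> closure (range A) \<and> x \<noteq> 0}"

definition A_spectral_radius ::
    "('a::complex_hilbert_space \<Rightarrow> 'a) \<Rightarrow> ('a \<Rightarrow> 'a) \<Rightarrow> real"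
  where "A_spectral_radius A T = Inf {root n (A_opnorm A (T ^^ n)) | n. n > 0}"

definition A_numerical_radius ::
    "('a::complex_hilbert_space \<Rightarrow> 'a) \<Rightarrow> ('a \<Rightarrow> 'a) \<Rightarrow> real"
  where "A_numerical_radius A T =
    Sup {cmod (A_inner A (T x) x) | x. A_seminorm A x = 1}"

end

theory Submission
  imports Defs
begin

text \<open>
  If \<open>w\<close> bounds the numerical radius of \<open>T\<close> with respect to the positive form
  \<open>B = \<langle>A\<cdot>, \<cdot>\<rangle>\<close>, then \<open>w\<^sup>n\<close> bounds that of \<open>T\<^sup>n\<close>. Following Pearcy, take
  \<open>z\<^sub>j\<close> running over the \<open>n\<close>-th roots of a unimodular number \<open>d\<close> and put
  \<open>y\<^sub>j = \<Sum>m<n. z\<^sub>j\<^sup>m w\<^sup>n\<^sup>-\<^sup>1\<^sup>-\<^sup>m T\<^sup>m x\<close>. Then \<open>(w - z\<^sub>j T) y\<^sub>j = (w\<^sup>n - d T\<^sup>n) x\<close> does not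
  depend on \<open>j\<close>, and the \<open>y\<^sub>j\<close> add up to a positive multiple of \<open>x\<close>, so
  \<open>Re (B ((w\<^sup>n - d T\<^sup>n) x) x)\<close> is a positive multiple of
  \<open>\<Sum>j. Re (B ((w - z\<^sub>j T) y\<^sub>j) y\<^sub>j) \<ge> 0\<close>. By polarization the seminorm of
  \<open>T\<^sup>n\<close> is at most \<open>2 w\<^sup>n\<close>, and \<open>2\<close> disappears after taking \<open>n\<close>-th roots.
\<close>

section \<open>Complex-linear maps and the inner product\<close>

interpretation complex_vector: vector_space
  "scaleC :: complex \<Rightarrow> 'a::complex_inner_space \<Rightarrow> 'a"
  by unfold_locales
    (simp_all add: scaleC_add_right scaleC_add_left scaleC_scaleC scaleC_one)

abbreviation clinear :: "('a::complex_inner_space \<Rightarrow> 'a) \<Rightarrow> bool"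
  where "clinear \<equiv> Vector_Spaces.linear scaleC scaleC"

lemma clinear_add: "clinear T \<Longrightarrow> T (x + y) = T x + T y"
  by (rule Vector_Spaces.linear.axioms(3)[THEN module_hom.add])

lemma clinear_scale: "clinear T \<Longrightarrow> T (c *\<^sub>C x) = c *\<^sub>C T x"
  by (rule Vector_Spaces.linear.axioms(3)[THEN module_hom.scale])

lemma clinear_diff: "clinear T \<Longrightarrow> T (x - y) = T x - T y"
  by (rule Vector_Spaces.linear.axioms(3)[THEN module_hom.diff])

lemma clinear_sum: "clinear T \<Longrightarrow> T (\<Sum>i\<in>I. f i) = (\<Sum>i\<in>I. T (f i))"
  by (rule Vector_Spaces.linear.axioms(3)[THEN module_hom.sum])

lemma clinear_funpow:
  assumes "clinear T"
  shows "clinear (T ^^ n)"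
proof (induction n)
  case 0
  show ?case using complex_vector.linear_id by (simp add: id_def)
next
  case (Suc n)
  show ?case using Vector_Spaces.linear_compose[OF Suc assms] by (simp add: comp_def)
qed

lemma cinner_add_right: "cinner x (y + z) = cinner x y + cinner x z"
  by (metis cinner_add_left cinner_commute complex_cnj_add)

lemma cinner_scaleC_right: "cinner x (c *\<^sub>C y) = cnj c * cinner x y"
  by (metis cinner_scaleC_left cinner_commute complex_cnj_mult)

section \<open>Roots of unity and phases\<close>

lemma cis_root_of_unity:
  assumes "n > 0"
  shows "cis (2 * pi * real j / real n) ^ n = 1"
proof -
  have "real n * (2 * pi * real j / real n) = 2 * pi * real j"
    using assms by simp
  then show ?thesis
    by (simp only: Complex.DeMoivre cis_multiple_2pi Ints_of_nat)
qed

text \<open>The \<open>m\<close>-th powers of the roots are the successive powers of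
  \<open>cis (2 * pi * real m / real n)\<close>. For \<open>0 < m < n\<close> this root of unity
  differs from 1, so its geometric sum vanishes.\<close>

lemma sum_powers_roots_of_unity:
  assumes "m < n"
  shows "(\<Sum>j<n. cis (2 * pi * real j / real n) ^ m) = (if m = 0 then of_nat n else 0)"
proof (cases "m = 0")
  case False
  let ?w = "cis (2 * pi * real m / real n)"
  have "?w \<noteq> cis (2 * pi * real 0 / real n)"
    using inj_onD[OF bij_betw_imp_inj_on[OF Complex.bij_betw_roots_unity[of n]], of m 0] assms False
    by fastforce
  then have "?w \<noteq> 1" by simp
  moreover have "?w ^ n = 1"
    using assms by (intro cis_root_of_unity) simp
  moreover have "cis (2 * pi * real j / real n) ^ m = ?w ^ j" for j
    by (simp add: Complex.DeMoivre mult_ac)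
  ultimately show ?thesis
    using False by (simp add: geometric_sum)
qed simp

text \<open>The phase of \<open>z\<close> is cancelled by an \<open>n\<close>-th power, so that
  \<open>c\<close> times the \<open>n\<close>-th roots of unity gives all \<open>n\<close>-th roots
  of the cancelling factor.\<close>

lemma exists_rotation_onto_nonneg_real:
  assumes "n > 0"
  shows "\<exists>c. cmod c = 1 \<and> c ^ n * z = of_real (cmod z)"
proof (intro exI conjI)
  let ?c = "cis (- Arg z / real n)"
  show "cmod ?c = 1" by simp
  have "?c ^ n = cis (- Arg z)" unfolding Complex.DeMoivre using assms by simp
  then have "?c ^ n * z = cis (- Arg z) * rcis (cmod z) (Arg z)"
    by (simp add: rcis_cmod_Arg)
  also have "\<dots> = of_real (cmod z)"
    by (simp add: rcis_def cis_mult)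
  finally show "?c ^ n * z = of_real (cmod z)" .
qed

section \<open>Positive sesquilinear forms, possibly degenerate\<close>

locale positive_sesquilinear =
  fixes B :: "'a::complex_inner_space \<Rightarrow> 'a \<Rightarrow> complex"
  assumes add_left: "B (x + y) z = B x z + B y z"
    and add_right: "B x (y + z) = B x y + B x z"
    and scale_left: "B (c *\<^sub>C x) y = c * B x y"
    and scale_right: "B x (c *\<^sub>C y) = cnj c * B x y"
    and self_nonneg: "B x x \<in> \<real>\<^sub>\<ge>\<^sub>0"
begin

lemma diff_left: "B (x - y) z = B x z - B y z"
  using add_left[of "x - y" y z] by (simp add: algebra_simps)

lemma diff_right: "B x (y - z) = B x y - B x z"
  using add_right[of x "y - z" z] by (simp add: algebra_simps)

lemma zero_right: "B x 0 = 0"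
  using diff_right[of x 0 0] by simp

lemma sum_right: "B x (\<Sum>i\<in>I. f i) = (\<Sum>i\<in>I. B x (f i))"
  by (induction I rule: infinite_finite_induct) (simp_all add: zero_right add_right)

lemma Re_self_nonneg: "0 \<le> Re (B x x)"
  using self_nonneg[of x] by (simp add: complex_nonneg_Reals_iff)

lemma cmod_self: "cmod (B x x) = Re (B x x)"
  using self_nonneg[of x] by (simp add: complex_nonneg_Reals_iff cmod_eq_Re)

lemma parallelogram: "Re (B (x + y) (x + y)) + Re (B (x - y) (x - y)) = 2 * Re (B x x) + 2 * Re (B y y)"
  by (simp add: add_left add_right diff_left diff_right)

text \<open>Polarization writes \<open>4 * B (S x) y\<close> through four values of
  \<open>B (S u) u\<close>; the parallelogram law adds up their bounds, and \<open>\<i>\<close>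
  drops out because it has modulus 1.\<close>

lemma polarization_bound:
  assumes S: "clinear S"
    and v: "\<And>u. cmod (B (S u) u) \<le> v * Re (B u u)"
  shows "cmod (B (S x) y) \<le> v * (Re (B x x) + Re (B y y))"
proof -
  let ?Q = "\<lambda>u. B (S u) u"
  let ?iy = "\<i> *\<^sub>C y"
  have "4 * B (S x) y = (?Q (x + y) - ?Q (x - y)) + \<i> * (?Q (x + ?iy) - ?Q (x - ?iy))"
    by (simp add: clinear_add[OF S] clinear_diff[OF S] clinear_scale[OF S]
        add_left add_right diff_left diff_right scale_left scale_right algebra_simps)
  then have "cmod (4 * B (S x) y) \<le>
      cmod (?Q (x + y) - ?Q (x - y)) + cmod (\<i> * (?Q (x + ?iy) - ?Q (x - ?iy)))"
    by (simp only: norm_triangle_ineq)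
  also have "\<dots> \<le> (cmod (?Q (x + y)) + cmod (?Q (x - y))) + (cmod (?Q (x + ?iy)) + cmod (?Q (x - ?iy)))"
    unfolding norm_mult norm_ii mult_1 by (intro add_mono norm_triangle_ineq4)
  also have "\<dots> \<le> v * (Re (B (x + y) (x + y)) + Re (B (x - y) (x - y)))
      + v * (Re (B (x + ?iy) (x + ?iy)) + Re (B (x - ?iy) (x - ?iy)))"
    unfolding distrib_left by (intro add_mono v)
  also have "\<dots> = 4 * (v * (Re (B x x) + Re (B y y)))"
    unfolding parallelogram by (simp add: scale_left scale_right algebra_simps)
  finally show ?thesis by (simp add: norm_mult)
qed

text \<open>Polarization for the identity map. This weak form of Cauchy-Schwarz suffices for
  finiteness of the numerical radius and for finding a vector of positive seminorm.\<close>

lemma cmod_le_add_self: "cmod (B x y) \<le> Re (B x x) + Re (B y y)"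
proof -
  have "clinear (id :: 'a \<Rightarrow> 'a)" by (rule complex_vector.linear_id)
  moreover have "cmod (B (id u) u) \<le> 1 * Re (B u u)" for u
    by (simp add: cmod_self)
  ultimately show ?thesis using polarization_bound[of id 1 x y] by simp
qed

lemma self_image_le:
  assumes S: "clinear S"
    and v: "\<And>u. cmod (B (S u) u) \<le> v * Re (B u u)"
    and pos: "Re (B x x) > 0"
  shows "sqrt (Re (B (S x) (S x))) \<le> 2 * v * sqrt (Re (B x x))"
proof -
  define a b where "a = sqrt (Re (B x x))" and "b = sqrt (Re (B (S x) (S x)))"
  have a: "a > 0" "Re (B x x) = a\<^sup>2" and b: "b \<ge> 0" "Re (B (S x) (S x)) = b\<^sup>2"
    using pos Re_self_nonneg[of "S x"] by (simp_all add: a_def b_def)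
  have v0: "0 \<le> v"
    using order_trans[OF norm_ge_zero v[of x]] pos by (simp add: zero_le_mult_iff)
  show ?thesis
  proof (cases "b = 0")
    case True
    then show ?thesis using a v0 by (simp flip: a_def b_def)
  next
    case False
    \<comment> \<open>This scaling gives \<open>t * S x\<close> the same seminorm \<open>a\<close>
      as \<open>x\<close>, so both terms of the polarization bound become \<open>a\<^sup>2\<close>
      and the left side becomes \<open>a * b\<close>.\<close>
    define t where "t = a / b"
    have t: "t > 0" using False a b by (simp add: t_def)
    have "cmod (B (S x) (of_real t *\<^sub>C S x)) = t * b\<^sup>2"
      using t by (simp add: scale_right norm_mult cmod_self b)
    moreover have "Re (B (of_real t *\<^sub>C S x) (of_real t *\<^sub>C S x)) = t\<^sup>2 * b\<^sup>2"
      by (simp add: scale_left scale_right b power2_eq_square)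
    ultimately have "t * b\<^sup>2 \<le> v * (a\<^sup>2 + t\<^sup>2 * b\<^sup>2)"
      using polarization_bound[OF S v, of x "of_real t *\<^sub>C S x"] a by simp
    then have "a * b \<le> a * (2 * v * a)"
      using False by (simp add: t_def power2_eq_square mult_ac)
    then show ?thesis using a by (simp flip: a_def b_def)
  qed
qed

theorem numerical_radius_power:
  assumes T: "clinear T"
    and w: "w > 0" "\<And>u. cmod (B (T u) u) \<le> w * Re (B u u)"
    and n: "n > 0"
  shows "cmod (B ((T ^^ n) x) x) \<le> w ^ n * Re (B x x)"
proof -
  obtain c where c: "cmod c = 1"
    and rot: "c ^ n * B ((T ^^ n) x) x = of_real (cmod (B ((T ^^ n) x) x))"
    using exists_rotation_onto_nonneg_real[OF n] by blast
  \<comment> \<open>These are the \<open>n\<close>-th roots of \<open>c ^ n\<close>, the number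
    \<open>d\<close> of the overview.\<close>
  define z where "z j = c * cis (2 * pi * real j / real n)" for j :: nat
  define y where "y j = (\<Sum>m<n. (z j ^ m * of_real (w ^ (n - 1 - m))) *\<^sub>C (T ^^ m) x)" for j
  define u where "u = of_real (w ^ n) *\<^sub>C x - c ^ n *\<^sub>C (T ^^ n) x"
  have z_norm: "cmod (z j) = 1" for j by (simp add: z_def c norm_mult)
  have z_pow: "z j ^ n = c ^ n" for j
    using n by (simp add: z_def power_mult_distrib cis_root_of_unity)
  \<comment> \<open>Applying \<open>z j * T\<close> to a summand of \<open>y j\<close> gives
    \<open>w\<close> times the next one, so the difference telescopes; only its end terms remain,
    and they involve \<open>z j\<close> only through \<open>z j ^ n\<close>.\<close>
  have yu: "of_real w *\<^sub>C y j - z j *\<^sub>C T (y j) = u" for j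
  proof -
    let ?g = "\<lambda>m. (z j ^ m * of_real (w ^ (n - m))) *\<^sub>C (T ^^ m) x"
    have "of_real w *\<^sub>C (z j ^ m * of_real (w ^ (n - 1 - m))) *\<^sub>C (T ^^ m) x = ?g m"
      if "m < n" for m
    proof -
      have "n - m = Suc (n - 1 - m)" using that by simp
      then show ?thesis by (simp add: scaleC_scaleC mult_ac)
    qed
    moreover have "z j *\<^sub>C T ((z j ^ m * of_real (w ^ (n - 1 - m))) *\<^sub>C (T ^^ m) x) = ?g (Suc m)" for m
      by (simp add: clinear_scale[OF T] scaleC_scaleC mult_ac)
    ultimately have "of_real w *\<^sub>C y j - z j *\<^sub>C T (y j) = (\<Sum>m<n. ?g m - ?g (Suc m))"
      unfolding y_def clinear_sum[OF T] complex_vector.scale_sum_right sum_subtractf[symmetric]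
      by (intro sum.cong refl) (simp only: lessThan_iff)
    also have "\<dots> = ?g 0 - ?g n" by (rule sum_lessThan_telescope')
    finally show ?thesis by (simp add: u_def z_pow)
  qed
  \<comment> \<open>Summing over \<open>j\<close> first kills every power of \<open>T\<close> except
    \<open>m = 0\<close>.\<close>
  have sum_y: "(\<Sum>j<n. y j) = of_real (real n * w ^ (n - 1)) *\<^sub>C x"
  proof -
    have "(\<Sum>j<n. y j) = (\<Sum>m<n. \<Sum>j<n. (z j ^ m * of_real (w ^ (n - 1 - m))) *\<^sub>C (T ^^ m) x)"
      unfolding y_def by (rule sum.swap)
    also have "\<dots> = (\<Sum>m<n. (c ^ m * (\<Sum>j<n. cis (2 * pi * real j / real n) ^ m)
        * of_real (w ^ (n - 1 - m))) *\<^sub>C (T ^^ m) x)"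
      by (simp add: z_def power_mult_distrib sum_distrib_left sum_distrib_right
          complex_vector.scale_sum_left)
    also have "\<dots> = (\<Sum>m<n. if m = 0 then of_real (real n * w ^ (n - 1)) *\<^sub>C x else 0)"
      by (rule sum.cong) (simp_all add: sum_powers_roots_of_unity)
    finally show ?thesis using n by simp
  qed
  have "0 \<le> Re (B u (y j))" for j
  proof -
    have "cmod (z j * B (T (y j)) (y j)) \<le> w * Re (B (y j) (y j))"
      using w(2) by (simp add: norm_mult z_norm)
    then have "Re (z j * B (T (y j)) (y j)) \<le> w * Re (B (y j) (y j))"
      using complex_Re_le_cmod order_trans by blast
    then show ?thesis
      by (subst yu[of j, symmetric]) (simp add: diff_left scale_left)
  qed
  then have "0 \<le> Re (B u (\<Sum>j<n. y j))"
    by (simp add: sum_right sum_nonneg)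
  also have "\<dots> = (real n * w ^ (n - 1)) * Re (B u x)"
    unfolding sum_y scale_right complex_cnj_complex_of_real Re_complex_of_real
    by (simp del: of_real_mult of_real_power)
  finally have "0 \<le> Re (B u x)"
    using n w(1) by (simp only: zero_le_mult_iff) (smt (verit) mult_pos_pos of_nat_0_less_iff zero_less_power)
  \<comment> \<open>The choice of \<open>c\<close> turns the term with \<open>T ^^ n\<close> into
    its modulus.\<close>
  also have "Re (B u x) = w ^ n * Re (B x x) - cmod (B ((T ^^ n) x) x)"
    by (simp add: u_def diff_left scale_left rot del: of_real_power)
  finally show ?thesis by simp
qed

end

section \<open>The form of a positive operator and the two radii\<close>

lemma positive_sesquilinear_A_inner:
  assumes "positive_operator A"
  shows "positive_sesquilinear (A_inner A)"
proof -
  have "clinear A"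
    using assms by (simp add: positive_operator_def bounded_operators_def)
  then show ?thesis
    using assms
    by unfold_locales
      (simp_all add: A_inner_def clinear_add clinear_scale cinner_add_left cinner_add_right
        cinner_scaleC_left cinner_scaleC_right positive_operator_def)
qed

theorem theorem2p3:
  fixes A T :: "'a::complex_hilbert_space \<Rightarrow> 'a"
  assumes "\<exists>x::'a. x \<noteq> 0"
    and "positive_operator A"
    and "A \<noteq> (\<lambda>x. 0)"
    and "T \<in> A_bounded_operators A"
  shows "A_spectral_radius A T \<le> A_numerical_radius A T"
proof -
  interpret positive_sesquilinear "A_inner A"
    by (rule positive_sesquilinear_A_inner[OF assms(2)])
  let ?q = "\<lambda>x. Re (A_inner A x x)"
  let ?N = "{cmod (A_inner A (T x) x) | x. A_seminorm A x = 1}"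
  have T: "clinear T"
    using assms(4) by (simp add: A_bounded_operators_def bounded_operators_def)
  obtain K where K: "\<And>x. A_seminorm A (T x) \<le> K * A_seminorm A x"
    using assms(4) by (auto simp: A_bounded_operators_def)
  \<comment> \<open>A crude constant: it makes the supremum finite and forces the form to vanish at
    vectors of zero seminorm, which cannot be normalized.\<close>
  have form_T_le: "cmod (A_inner A (T x) x) \<le> (K\<^sup>2 + 1) * ?q x" for x
  proof -
    have "(A_seminorm A (T x))\<^sup>2 \<le> (K * A_seminorm A x)\<^sup>2"
      by (rule power_mono[OF K]) (simp add: A_seminorm_def Re_self_nonneg)
    then have "?q (T x) \<le> K\<^sup>2 * ?q x"
      by (simp add: A_seminorm_def Re_self_nonneg power_mult_distrib)
    then show ?thesis
      using cmod_le_add_self[of "T x" x] by (simp add: algebra_simps)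
  qed
  have bdd_N: "bdd_above ?N"
  proof (rule bdd_aboveI)
    fix r assume "r \<in> ?N"
    then obtain x where "r = cmod (A_inner A (T x) x)" "?q x = 1"
      by (auto simp: A_seminorm_def)
    then show "r \<le> K\<^sup>2 + 1"
      using form_T_le[of x] by simp
  qed
  have normalize: "A_seminorm A (of_real (1 / sqrt (?q x)) *\<^sub>C x) = 1" if "?q x > 0" for x
    using that by (simp add: A_seminorm_def scale_left scale_right flip: power2_eq_square)
  have form_T_le_radius: "cmod (A_inner A (T x) x) \<le> A_numerical_radius A T * ?q x" for x
  proof (cases "?q x > 0")
    case True
    let ?e = "of_real (1 / sqrt (?q x)) *\<^sub>C x"
    have "cmod (A_inner A (T ?e) ?e) \<le> A_numerical_radius A T"
      unfolding A_numerical_radius_def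
      by (rule cSup_upper[OF _ bdd_N]) (use normalize[OF True] in blast)
    moreover have "cmod (A_inner A (T ?e) ?e) = cmod (A_inner A (T x) x) / ?q x"
      using True
      by (simp add: clinear_scale[OF T] scale_left scale_right norm_mult norm_divide)
    ultimately show ?thesis using True by (simp only: divide_le_eq if_True)
  next
    case False
    then have "?q x = 0" using Re_self_nonneg[of x] by simp
    then show ?thesis using form_T_le[of x] by simp
  qed
  obtain p where p: "A p \<noteq> 0" using assms(3) by auto
  \<comment> \<open>If \<open>?q\<close> vanished everywhere, the weak Cauchy-Schwarz bound at
    \<open>p\<close> and \<open>A p\<close> would give \<open>A p = 0\<close>.\<close>
  have "\<exists>x. ?q x > 0"
  proof (rule ccontr)
    assume "\<not> ?thesis"
    then have "cmod (cinner (A p) (A p)) \<le> 0"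
      using cmod_le_add_self[of p "A p"] unfolding A_inner_def
      by (smt (verit, best))
    then show False using p by (simp add: cinner_eq_zero_iff)
  qed
  then obtain e where e: "?q e > 0" by blast
  have radius_nonneg: "0 \<le> A_numerical_radius A T"
    using order_trans[OF norm_ge_zero form_T_le_radius[of e]] e
    by (simp add: zero_le_mult_iff)
  \<comment> \<open>A strict upper bound \<open>w\<close> is positive even when the radius is 0, as
    the power inequality requires; \<open>dense_ge\<close> then passes to the radius itself.\<close>
  have "A_spectral_radius A T \<le> w" if w: "A_numerical_radius A T < w" for w
  proof -
    have w0: "w > 0" using w radius_nonneg by simp
    have "cmod (A_inner A (T x) x) \<le> w * ?q x" for x
      using form_T_le_radius[of x] mult_right_mono[OF less_imp_le[OF w] Re_self_nonneg[of x]]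
      by linarith
    then have form_pow: "cmod (A_inner A ((T ^^ n) x) x) \<le> w ^ n * ?q x" if "n > 0" for n x
      using numerical_radius_power[OF T w0 _ that] by blast
    have ratio: "A_seminorm A ((T ^^ n) x) / A_seminorm A x \<le> 2 * w ^ n" if "n > 0" for n x
    proof (cases "?q x > 0")
      case True
      then show ?thesis
        using self_image_le[OF clinear_funpow[OF T] form_pow[OF that] True]
        by (simp add: A_seminorm_def divide_le_eq)
    next
      case False
      \<comment> \<open>The quotient is \<open>0\<close> here because its denominator is.\<close>
      then have "?q x = 0" using Re_self_nonneg[of x] by simp
      then show ?thesis using w0 by (simp add: A_seminorm_def)
    qed
    have opnorm: "0 \<le> A_opnorm A (T ^^ n)" "A_opnorm A (T ^^ n) \<le> 2 * w ^ n" if "n > 0" for n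
    proof -
      let ?S = "{A_seminorm A ((T ^^ n) x) / A_seminorm A x | x. x \<in> closure (range A) \<and> x \<noteq> 0}"
      \<comment> \<open>The nonzero vector \<open>A p\<close> of the range makes the set nonempty;
        its quotient also bounds the supremum below by 0, which later bounds the set of roots
        below.\<close>
      have mem: "A_seminorm A ((T ^^ n) (A p)) / A_seminorm A (A p) \<in> ?S"
        using p closure_subset[of "range A"] by blast
      have le: "r \<le> 2 * w ^ n" if "r \<in> ?S" for r
        using that ratio[OF \<open>n > 0\<close>] by blast
      show "A_opnorm A (T ^^ n) \<le> 2 * w ^ n"
        unfolding A_opnorm_def by (rule cSup_least) (use mem le in blast)+
      have "0 \<le> A_seminorm A ((T ^^ n) (A p)) / A_seminorm A (A p)"
        by (simp add: A_seminorm_def Re_self_nonneg)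
      also have "\<dots> \<le> A_opnorm A (T ^^ n)"
        unfolding A_opnorm_def by (rule cSup_upper[OF mem bdd_aboveI[OF le]])
      finally show "0 \<le> A_opnorm A (T ^^ n)" .
    qed
    have "A_spectral_radius A T \<le> root n 2 * w" if "n > 0" for n
    proof -
      have "A_spectral_radius A T \<le> root n (A_opnorm A (T ^^ n))"
        unfolding A_spectral_radius_def
      proof (rule cInf_lower)
        show "bdd_below {root n (A_opnorm A (T ^^ n)) | n. n > 0}"
          by (rule bdd_belowI[of _ 0]) (use opnorm(1) in auto)
      qed (use that in blast)
      also have "\<dots> \<le> root n (2 * w ^ n)"
        using that opnorm(2) by simp
      also have "\<dots> = root n 2 * w"
        using that w0 by (simp add: real_root_mult real_root_power_cancel)
      finally show ?thesis .
    qed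
    then have "\<forall>\<^sub>F n in sequentially. A_spectral_radius A T \<le> root n 2 * w"
      using eventually_gt_at_top[of 0] by (rule eventually_mono[rotated])
    moreover have "(\<lambda>n. root n 2 * w) \<longlonglongrightarrow> 1 * w"
      by (intro tendsto_mult LIMSEQ_root_const tendsto_const) simp
    ultimately show ?thesis
      using tendsto_lowerbound[of "\<lambda>n. root n 2 * w" w sequentially] by simp
  qed
  then show ?thesis by (rule dense_ge)
qed

end
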